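(* Let $b\ge 2$ and $q$ be integers with $3\leq q\leq b/(2\ln b)$, and let $T$ be the complete $b$-ary tree with $n$ vertices. Let $\mathcal{M}$ be the Metropolis Glauber dynamics for sampling proper $q$-colourings of $T$. Then for fixed $q$ and $b$ the mixing time $\tau(\mathcal{M},1/(2e))$ is $n^{\Omega(b/(q\log b))}$, where the constant implicit in the $\Omega()$ notation does not depend on $n$, $q$ or $b$. In particular, $$\tau(\mathcal{M},1/(2e)) \geq \left(\frac12-\frac1{2e}\right)\frac29\, n^{\frac{b-2}{6(q-1)\ln b}}.$$
   Context: The complete $b$-ary tree of height $H$ has a root, every non-leaf vertex has exactly $b$ children, and every root-to-leaf path has $H$ edges; it has $n=(b^{H+1}-1)/(b-1)$ vertices. A proper $q$-colouring is a map from the vertices to $[q]=\{0,\dots,q-1\}$ giving adjacent vertices different colours; $\Omega$ denotes the set of proper $q$-colourings of $T$. The Metropolis Glauber dynamics $\mathcal{M}$ is the Markov chain on $\Omega$ which, from the current colouring, chooses a vertex $v$ uniformly at random and a colour $c\in[q]$ uniformly at random, and recolours $v$ with $c$ if and only if the result is a proper colouring (otherwise it stays put). For $q\ge 3$ it converges to the uniform distribution $\pi$ on $\Omega$. With $P$ its transition matrix and $\|\theta_1-\theta_2\|=\max_{A\subseteq\Omega}|\theta_1(A)-\theta_2(A)|$ the total variation distance, $\tau_x(\mathcal{M},\delta)=\min\{t>0: \|P^{t'}(x,\cdot)-\pi\|\le\delta \text{ for all } t'\ge t\}$ and $\tau(\mathcal{M},\delta)=\max_{x\in\Omega}\tau_x(\mathcal{M},\delta)$.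 Here $\ln$ is the natural logarithm. *)

theory Defs
  imports "HOL-Probability.Probability"
begin

section \<open>Complete trees and proper colourings\<close>

text \<open>
  A vertex of the complete b-ary tree is identified with the list of child indices
  on the path from the root (the empty list) to it.
\<close>

definition tree_verts :: "nat \<Rightarrow> nat \<Rightarrow> nat list set" where
  "tree_verts b H = {v. set v \<subseteq> {..<b} \<and> length v \<le> H}"

definition tree_adj :: "nat list \<Rightarrow> nat list \<Rightarrow> bool" where
  "tree_adj u v \<longleftrightarrow> (\<exists>i. v = u @ [i]) \<or> (\<exists>i. u = v @ [i])"

lemma finite_tree_verts: "finite (tree_verts b H)"
  unfolding tree_verts_def by (rule finite_lists_length_le) simp

lemma card_tree_verts:
  assumes "b \<ge> 2"
  shows "card (tree_verts b H) = (b ^ (H + 1) - 1) div (b - 1)"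
proof -
  have "card (tree_verts b H) = (\<Sum>i\<le>H. b ^ i)"
    unfolding tree_verts_def using card_lists_length_le[of "{..<b}" H] by simp
  moreover have "int ((b - 1) * (\<Sum>i\<le>H. b ^ i)) = int (b ^ (H + 1) - 1)"
    using assms power_diff_1_eq[of "int b" "Suc H"]
    by (simp add: of_nat_diff lessThan_Suc_atMost)
  ultimately have "(b - 1) * card (tree_verts b H) = b ^ (H + 1) - 1"
    by (simp only: of_nat_eq_iff)
  then show ?thesis
    using assms by (metis Suc_1 diff_is_0_eq nonzero_mult_div_cancel_left not_less_eq_eq)
qed

text \<open>
  Colourings are extensional (undefined outside the vertex set), so that they are
  determined by their values on the vertices and there are only finitely many.
\<close>

definition proper_colourings :: "'v set \<Rightarrow> ('v \<Rightarrow> 'v \<Rightarrow> bool) \<Rightarrow> nat \<Rightarrow> ('v \<Rightarrow> nat) set" where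
  "proper_colourings V adj q =
    {x \<in> V \<rightarrow>\<^sub>E {..<q}. \<forall>u\<in>V. \<forall>v\<in>V. adj u v \<longrightarrow> x u \<noteq> x v}"


section \<open>Mixing time\<close>

definition tv_dist :: "'s set \<Rightarrow> 's pmf \<Rightarrow> 's pmf \<Rightarrow> real" where
  "tv_dist S \<theta>1 \<theta>2 =
    Max ((\<lambda>A. \<bar>measure_pmf.prob \<theta>1 A - measure_pmf.prob \<theta>2 A\<bar>) ` Pow S)"

text \<open>A Markov chain is given by its kernel \<open>K\<close>, where \<open>K x\<close> is row \<open>x\<close> of the transition matrix.\<close>

definition chain_dist :: "('s \<Rightarrow> 's pmf) \<Rightarrow> nat \<Rightarrow> 's \<Rightarrow> 's pmf" where
  "chain_dist K t x = ((\<lambda>\<mu>. bind_pmf \<mu> K) ^^ t) (return_pmf x)"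

text \<open>
  Values are extended naturals, with \<open>\<infinity>\<close> for a chain that does not get within \<open>\<delta>\<close> of \<open>\<pi>\<close>
  for good; otherwise the infimum is attained.
\<close>

definition mixing_time_from ::
    "'s set \<Rightarrow> ('s \<Rightarrow> 's pmf) \<Rightarrow> 's pmf \<Rightarrow> real \<Rightarrow> 's \<Rightarrow> enat" where
  "mixing_time_from S K \<pi> \<delta> x =
    Inf (enat ` {t. t > 0 \<and> (\<forall>t'\<ge>t. tv_dist S (chain_dist K t' x) \<pi> \<le> \<delta>)})"

definition mixing_time :: "'s set \<Rightarrow> ('s \<Rightarrow> 's pmf) \<Rightarrow> 's pmf \<Rightarrow> real \<Rightarrow> enat" where
  "mixing_time S K \<pi> \<delta> = Max (mixing_time_from S K \<pi> \<delta> ` S)"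


section \<open>Metropolis Glauber dynamics\<close>

definition glauber_step ::
    "'v set \<Rightarrow> ('v \<Rightarrow> 'v \<Rightarrow> bool) \<Rightarrow> nat \<Rightarrow> ('v \<Rightarrow> nat) \<Rightarrow> ('v \<Rightarrow> nat) pmf" where
  "glauber_step V adj q x =
    bind_pmf (pmf_of_set V) (\<lambda>v.
    bind_pmf (pmf_of_set {..<q}) (\<lambda>c.
    return_pmf (if x(v := c) \<in> proper_colourings V adj q then x(v := c) else x)))"

definition tree_glauber_mixing_time :: "nat \<Rightarrow> nat \<Rightarrow> nat \<Rightarrow> real \<Rightarrow> enat" where
  "tree_glauber_mixing_time b H q \<delta> =
    (let V = tree_verts b H; \<Omega> = proper_colourings V tree_adj q
     in mixing_time \<Omega> (glauber_step V tree_adj q) (pmf_of_set \<Omega>) \<delta>)"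

end

theory Submission
  imports Defs
begin

text \<open>
  The leaves alone may determine the colour of the root: a vertex is forced to the colour \<open>c\<close> if every
  other colour is forced at one of its children. Let \<open>S\<close> be the set of colourings whose leaves
  force the colour 0 at the root. When \<open>q \<le> b / (2 ln b)\<close>, at least two thirds of the colourings
  with root colour 0 lie in \<open>S\<close>. A step leaves \<open>S\<close> only by recolouring a leaf, and then at every vertex
  \<open>v\<close> on the path from that leaf to the root the children of \<open>v\<close> off the path must fail to force
  all the colours other than that of \<open>v\<close>. These failures are independent
  given the colours on the path, and each has probability at most \<open>exp (- (b - 1) / (6 (q - 1)))\<close>.
  So \<open>S\<close> is a bottleneck whose conductance is exponentially small in \<open>H (b - 1) / (q - 1)\<close>, that is,
  at most a constant times \<open>n\<close> to the power \<open>- (b - 2) / (6 (q - 1) ln b)\<close>.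
  Absorbing the constant factor, for the \<open>\<Omega>\<close>-statement, uses the bound linear in \<open>n\<close> that comes from
  the bottleneck of all colourings with root colour 0.
\<close>

section \<open>Colourings of complete trees\<close>

lemma tree_adj_Cons [simp]: "tree_adj (i # u) (j # v) \<longleftrightarrow> i = j \<and> tree_adj u v"
  unfolding tree_adj_def by auto

lemma tree_adj_Nil_Cons [simp]: "tree_adj [] (j # v) \<longleftrightarrow> v = []" "tree_adj (j # v) [] \<longleftrightarrow> v = []"
  unfolding tree_adj_def by auto

lemma tree_adj_Nil_Nil [simp]: "\<not> tree_adj [] []"
  unfolding tree_adj_def by auto

lemma Nil_in_tree_verts [simp]: "[] \<in> tree_verts b h"
  unfolding tree_verts_def by simp

lemma tree_verts_nonempty [simp]: "tree_verts b h \<noteq> {}"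
  using Nil_in_tree_verts by blast

lemma Cons_in_tree_verts [simp]: "i # v \<in> tree_verts b (Suc h) \<longleftrightarrow> i < b \<and> v \<in> tree_verts b h"
  unfolding tree_verts_def by auto

definition tree_colourings :: "nat \<Rightarrow> nat \<Rightarrow> nat \<Rightarrow> (nat list \<Rightarrow> nat) set" where
  "tree_colourings b q h = proper_colourings (tree_verts b h) tree_adj q"

definition rooted_colourings :: "nat \<Rightarrow> nat \<Rightarrow> nat \<Rightarrow> nat \<Rightarrow> (nat list \<Rightarrow> nat) set" where
  "rooted_colourings b q h c = {x \<in> tree_colourings b q h. x [] = c}"

text \<open>The restriction makes a branch extensional again, hence a colouring of the smaller
  tree.\<close>

definition branch :: "nat \<Rightarrow> nat \<Rightarrow> nat \<Rightarrow> (nat list \<Rightarrow> nat) \<Rightarrow> nat list \<Rightarrow> nat" where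
  "branch b h i x = restrict (\<lambda>v. x (i # v)) (tree_verts b h)"

text \<open>Inverse to splitting a colouring into root colour and branches; \<open>undefined\<close>
  off the tree keeps the result extensional.\<close>

definition graft :: "nat \<Rightarrow> nat \<Rightarrow> nat \<Rightarrow> (nat \<Rightarrow> nat list \<Rightarrow> nat) \<Rightarrow> nat list \<Rightarrow> nat" where
  "graft b h c f v = (case v of [] \<Rightarrow> c
     | i # w \<Rightarrow> if v \<in> tree_verts b (Suc h) then f i w else undefined)"

lemma finite_tree_colourings [simp]: "finite (tree_colourings b q h)"
proof (rule finite_subset)
  show "tree_colourings b q h \<subseteq> tree_verts b h \<rightarrow>\<^sub>E {..<q}"
    unfolding tree_colourings_def proper_colourings_def by auto
qed (intro finite_PiE finite_tree_verts, simp)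

lemma finite_rooted_colourings [simp]: "finite (rooted_colourings b q h c)"
  unfolding rooted_colourings_def by simp

lemma rooted_subset_tree_colourings: "rooted_colourings b q h c \<subseteq> tree_colourings b q h"
  unfolding rooted_colourings_def by auto

lemma tree_colouring_root: "x \<in> tree_colourings b q h \<Longrightarrow> x [] < q"
  unfolding tree_colourings_def proper_colourings_def by (auto simp: PiE_iff)

lemma branch_in_tree_colourings:
  assumes "x \<in> tree_colourings b q (Suc h)" "i < b"
  shows "branch b h i x \<in> tree_colourings b q h" "branch b h i x [] \<noteq> x []"
proof -
  have x: "x \<in> tree_verts b (Suc h) \<rightarrow>\<^sub>E {..<q}"
    "\<And>u v. u \<in> tree_verts b (Suc h) \<Longrightarrow> v \<in> tree_verts b (Suc h) \<Longrightarrow> tree_adj u v \<Longrightarrow> x u \<noteq> x v"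
    using assms(1) unfolding tree_colourings_def proper_colourings_def by auto
  show "branch b h i x \<in> tree_colourings b q h"
    unfolding tree_colourings_def proper_colourings_def branch_def
    using x assms(2) by (auto simp: PiE_iff)
  show "branch b h i x [] \<noteq> x []"
    using x(2)[of "[i]" "[]"] assms(2) by (simp add: branch_def)
qed

text \<open>Every edge either lies inside one branch or joins the root to a child, so the two
  conditions on \<open>f\<close> cover all edges.\<close>

lemma graft_in_rooted_colourings:
  assumes c: "c < q"
    and f: "\<And>i. i < b \<Longrightarrow> f i \<in> tree_colourings b q h" "\<And>i. i < b \<Longrightarrow> f i [] \<noteq> c"
  shows "graft b h c f \<in> rooted_colourings b q (Suc h) c"
proof -
  have f1: "\<And>i v. i < b \<Longrightarrow> v \<in> tree_verts b h \<Longrightarrow> f i v < q"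
    using f(1) unfolding tree_colourings_def proper_colourings_def by (auto simp: PiE_iff)
  have f2: "\<And>i u v. i < b \<Longrightarrow> u \<in> tree_verts b h \<Longrightarrow> v \<in> tree_verts b h \<Longrightarrow> tree_adj u v
      \<Longrightarrow> f i u \<noteq> f i v"
    using f(1) unfolding tree_colourings_def proper_colourings_def by blast
  have "graft b h c f \<in> tree_verts b (Suc h) \<rightarrow>\<^sub>E {..<q}"
    using c f1 by (auto simp: PiE_iff graft_def extensional_def split: list.splits)
  moreover have "graft b h c f u \<noteq> graft b h c f v"
    if "u \<in> tree_verts b (Suc h)" "v \<in> tree_verts b (Suc h)" "tree_adj u v" for u v
    using that f(2) f2 by (cases u; cases v) (force simp: graft_def)+
  ultimately show ?thesis
    unfolding rooted_colourings_def tree_colourings_def proper_colourings_def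
    by (auto simp: graft_def)
qed

text \<open>Given the root colour, the branches can be chosen independently of each other. All later
  counts rest on this product structure.\<close>

lemma bij_betw_branches:
  assumes "c < q"
  shows "bij_betw (\<lambda>x. \<lambda>i\<in>{..<b}. branch b h i x) (rooted_colourings b q (Suc h) c)
           (\<Pi>\<^sub>E i\<in>{..<b}. {y \<in> tree_colourings b q h. y [] \<noteq> c})"
proof (rule bij_betw_byWitness[where f' = "graft b h c"])
  show "\<forall>x\<in>rooted_colourings b q (Suc h) c. graft b h c (\<lambda>i\<in>{..<b}. branch b h i x) = x"
  proof (intro ballI ext)
    fix x v assume x: "x \<in> rooted_colourings b q (Suc h) c"
    then have "x \<in> extensional (tree_verts b (Suc h))" "x [] = c"
      unfolding rooted_colourings_def tree_colourings_def proper_colourings_def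
      by (auto simp: PiE_iff)
    then show "graft b h c (\<lambda>i\<in>{..<b}. branch b h i x) v = x v"
      by (auto simp: graft_def branch_def extensional_def split: list.splits)
  qed
  show "\<forall>f\<in>\<Pi>\<^sub>E i\<in>{..<b}. {y \<in> tree_colourings b q h. y [] \<noteq> c}.
      (\<lambda>i\<in>{..<b}. branch b h i (graft b h c f)) = f"
  proof (intro ballI ext)
    fix f i v assume f: "f \<in> (\<Pi>\<^sub>E i\<in>{..<b}. {y \<in> tree_colourings b q h. y [] \<noteq> c})"
    then have "i < b \<Longrightarrow> f i \<in> extensional (tree_verts b h)"
      unfolding tree_colourings_def proper_colourings_def by (auto simp: PiE_iff)
    then show "(\<lambda>i\<in>{..<b}. branch b h i (graft b h c f)) i v = f i v"
      using f by (auto simp: graft_def branch_def extensional_def PiE_iff)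
  qed
  show "(\<lambda>x. \<lambda>i\<in>{..<b}. branch b h i x) ` rooted_colourings b q (Suc h) c
      \<subseteq> (\<Pi>\<^sub>E i\<in>{..<b}. {y \<in> tree_colourings b q h. y [] \<noteq> c})"
    using branch_in_tree_colourings by (fastforce simp: rooted_colourings_def)
  show "graft b h c ` (\<Pi>\<^sub>E i\<in>{..<b}. {y \<in> tree_colourings b q h. y [] \<noteq> c})
      \<subseteq> rooted_colourings b q (Suc h) c"
    using graft_in_rooted_colourings[OF assms] by (auto simp: PiE_iff)
qed

text \<open>The counting form of this independence: conditions on separate branches
  multiply.\<close>

lemma card_rooted_branches:
  assumes "c < q" and A: "\<And>i. i < b \<Longrightarrow> A i \<subseteq> {y \<in> tree_colourings b q h. y [] \<noteq> c}"
  shows "card {x \<in> rooted_colourings b q (Suc h) c. \<forall>i<b. branch b h i x \<in> A i} = (\<Prod>i<b. card (A i))"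
proof -
  let ?g = "\<lambda>x. \<lambda>i\<in>{..<b}. branch b h i x"
  let ?X = "{x \<in> rooted_colourings b q (Suc h) c. \<forall>i<b. branch b h i x \<in> A i}"
  note bij = bij_betw_branches[OF assms(1), of b h]
  have img: "?g ` ?X = (\<Pi>\<^sub>E i\<in>{..<b}. A i)"
  proof
    show "?g ` ?X \<subseteq> (\<Pi>\<^sub>E i\<in>{..<b}. A i)" by auto
    show "(\<Pi>\<^sub>E i\<in>{..<b}. A i) \<subseteq> ?g ` ?X"
    proof
      fix f assume f: "f \<in> (\<Pi>\<^sub>E i\<in>{..<b}. A i)"
      then have "f \<in> (\<Pi>\<^sub>E i\<in>{..<b}. {y \<in> tree_colourings b q h. y [] \<noteq> c})"
        using A by (meson PiE_mono lessThan_iff subsetD)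
      then have "f \<in> ?g ` rooted_colourings b q (Suc h) c"
        unfolding bij_betw_imp_surj_on[OF bij] .
      then obtain x where x: "x \<in> rooted_colourings b q (Suc h) c" "f = ?g x" ..
      have "branch b h i x \<in> A i" if "i < b" for i
        using PiE_mem[OF f, of i] that x(2) by simp
      then show "f \<in> ?g ` ?X" using x by blast
    qed
  qed
  have "inj_on ?g ?X"
    by (rule inj_on_subset[OF bij_betw_imp_inj_on[OF bij]]) auto
  from card_image[OF this] have "card ?X = card (\<Pi>\<^sub>E i\<in>{..<b}. A i)"
    unfolding img by (rule sym)
  then show ?thesis by (simp add: card_PiE)
qed

lemma card_tree_colourings_split:
  assumes "\<And>y. y \<in> B \<Longrightarrow> y [] < q"
  shows "card {y \<in> tree_colourings b q h. y [] \<noteq> c \<and> y \<in> B}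
    = (\<Sum>d\<in>{..<q} - {c}. card (rooted_colourings b q h d \<inter> B))"
proof -
  have "{y \<in> tree_colourings b q h. y [] \<noteq> c \<and> y \<in> B}
      = (\<Union>d\<in>{..<q} - {c}. rooted_colourings b q h d \<inter> B)"
    using assms by (auto simp: rooted_colourings_def)
  then show ?thesis
    by (subst card_UN_disjoint[symmetric]) (auto simp: rooted_colourings_def)
qed

text \<open>The number of colourings with a prescribed root colour, the same for each colour: each
  of the \<open>b\<close> children chooses among \<open>q - 1\<close> colours.\<close>

fun num_rooted :: "nat \<Rightarrow> nat \<Rightarrow> nat \<Rightarrow> nat" where
  "num_rooted b q 0 = 1"
| "num_rooted b q (Suc h) = ((q - 1) * num_rooted b q h) ^ b"

lemma tree_verts_0 [simp]: "tree_verts b 0 = {[]}"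
  unfolding tree_verts_def by auto

lemma rooted_colourings_0: "c < q \<Longrightarrow> rooted_colourings b q 0 c = {(\<lambda>v\<in>{[]}. c)}"
  unfolding rooted_colourings_def tree_colourings_def proper_colourings_def
  by (auto simp: PiE_iff extensional_def fun_eq_iff)

lemma card_rooted_colourings: "c < q \<Longrightarrow> card (rooted_colourings b q h c) = num_rooted b q h"
proof (induction h arbitrary: c)
  case 0
  then show ?case by (simp add: rooted_colourings_0)
next
  case (Suc h)
  have "card {y \<in> tree_colourings b q h. y [] \<noteq> c} = (q - 1) * num_rooted b q h"
    using Suc card_tree_colourings_split[of "tree_colourings b q h" q b h c]
    by (simp add: tree_colouring_root Int_absorb2 rooted_subset_tree_colourings cong: conj_cong)
  moreover have "rooted_colourings b q (Suc h) c = {x \<in> rooted_colourings b q (Suc h) c.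
       \<forall>i<b. branch b h i x \<in> {y \<in> tree_colourings b q h. y [] \<noteq> c}}"
    using branch_in_tree_colourings by (auto simp: rooted_colourings_def)
  ultimately show ?case
    using card_rooted_branches[OF Suc.prems, of b "\<lambda>_. {y \<in> tree_colourings b q h. y [] \<noteq> c}" h]
    by simp
qed

section \<open>Colours determined by the leaves\<close>

text \<open>The colours that the root can take in a proper colouring that agrees with \<open>x\<close> on the leaves:
  a colour is excluded iff the leaves force it at some child.\<close>

fun allowed :: "nat \<Rightarrow> nat \<Rightarrow> nat \<Rightarrow> (nat list \<Rightarrow> nat) \<Rightarrow> nat set" where
  "allowed b q 0 x = {x []}"
| "allowed b q (Suc h) x = {c \<in> {..<q}. \<forall>i<b. allowed b q h (\<lambda>v. x (i # v)) \<noteq> {c}}"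

text \<open>The recursion descends to the subtrees and evaluates the colouring only at height 0, so
  only words of length exactly \<open>h\<close> are read.\<close>

lemma allowed_cong:
  "(\<And>v. set v \<subseteq> {..<b} \<Longrightarrow> length v = h \<Longrightarrow> x v = y v) \<Longrightarrow> allowed b q h x = allowed b q h y"
proof (induction h arbitrary: x y)
  case (Suc h)
  have "allowed b q h (\<lambda>v. x (i # v)) = allowed b q h (\<lambda>v. y (i # v))" if "i < b" for i
    using that by (intro Suc.IH Suc.prems) auto
  then show ?case by auto
qed simp

text \<open>Restricting to a subtree does not touch its leaves. This form of the recursion replaces
  the defining equation from here on, since branches of proper colourings are again proper
  colourings.\<close>

lemma allowed_Suc_branch:
  "allowed b q (Suc h) x = {c \<in> {..<q}. \<forall>i<b. allowed b q h (branch b h i x) \<noteq> {c}}"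
proof -
  have "allowed b q h (branch b h i x) = allowed b q h (\<lambda>v. x (i # v))" for i
    by (rule allowed_cong) (auto simp: branch_def tree_verts_def)
  then show ?thesis by simp
qed

declare allowed.simps(2) [simp del]

text \<open>If the leaves forced \<open>x []\<close> at a child, then by induction the child would
  itself have colour \<open>x []\<close>, against properness.\<close>

lemma root_in_allowed: "x \<in> tree_colourings b q h \<Longrightarrow> x [] \<in> allowed b q h x"
proof (induction h arbitrary: x)
  case (Suc h)
  have "allowed b q h (branch b h i x) \<noteq> {x []}" if "i < b" for i
    using Suc.IH[of "branch b h i x"] branch_in_tree_colourings[OF Suc.prems that] by auto
  then show ?case
    unfolding allowed_Suc_branch using tree_colouring_root[OF Suc.prems] by simp
qed simp

section \<open>Colourings whose leaves force the colour of the root\<close>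

definition forced_colourings :: "nat \<Rightarrow> nat \<Rightarrow> nat \<Rightarrow> nat \<Rightarrow> (nat list \<Rightarrow> nat) set" where
  "forced_colourings b q h c = {x \<in> tree_colourings b q h. allowed b q h x = {c}}"

lemma forced_subset_rooted: "forced_colourings b q h c \<subseteq> rooted_colourings b q h c"
  using root_in_allowed by (fastforce simp: forced_colourings_def rooted_colourings_def)

lemma finite_forced_colourings [simp]: "finite (forced_colourings b q h c)"
  unfolding forced_colourings_def by simp

text \<open>The branches that may hang below a root of colour \<open>c\<close> without helping to
  exclude \<open>d\<close> there.\<close>

definition unforced_branches :: "nat \<Rightarrow> nat \<Rightarrow> nat \<Rightarrow> nat \<Rightarrow> nat \<Rightarrow> (nat list \<Rightarrow> nat) set" where
  "unforced_branches b q h c d = {y \<in> tree_colourings b q h. y [] \<noteq> c} - forced_colourings b q h d"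

lemma card_branches:
  assumes "c < q"
  shows "card {y \<in> tree_colourings b q h. y [] \<noteq> c} = (q - 1) * num_rooted b q h"
  using assms card_tree_colourings_split[of "tree_colourings b q h" q b h c]
  by (simp add: tree_colouring_root Int_absorb2 rooted_subset_tree_colourings card_rooted_colourings
      cong: conj_cong)

text \<open>The branches split into \<open>q - 1\<close> classes of equal size by root colour. As
  \<open>d\<close> differs from \<open>c\<close>, it is one of these colours, and its class loses at
  least two thirds of its members.\<close>

lemma card_unforced_branches:
  assumes "c < q" "d < q" "c \<noteq> d" "3 * card (forced_colourings b q h d) \<ge> 2 * num_rooted b q h"
  shows "real (card (unforced_branches b q h c d)) \<le> (real q - 1 - 2/3) * num_rooted b q h"
proof -
  have "forced_colourings b q h d \<subseteq> {y \<in> tree_colourings b q h. y [] \<noteq> c}"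
    using forced_subset_rooted[of b q h d] assms by (auto simp: rooted_colourings_def)
  then have "card (unforced_branches b q h c d) + card (forced_colourings b q h d)
      = card {y \<in> tree_colourings b q h. y [] \<noteq> c}"
    unfolding unforced_branches_def by (simp add: card_Diff_subset card_mono)
  then have "card (unforced_branches b q h c d) + card (forced_colourings b q h d) = (q - 1) * num_rooted b q h"
    unfolding card_branches[OF assms(1)] .
  then have "real (card (unforced_branches b q h c d)) + card (forced_colourings b q h d)
      = real ((q - 1) * num_rooted b q h)"
    by (simp only: of_nat_add[symmetric])
  also have "\<dots> = (real q - 1) * num_rooted b q h"
    using assms(1) by (simp add: of_nat_diff)
  finally have "real (card (unforced_branches b q h c d)) + card (forced_colourings b q h d)
      = (real q - 1) * num_rooted b q h" .
  moreover have "3 * real (card (forced_colourings b q h d)) \<ge> 2 * real (num_rooted b q h)"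
    using assms(4) by linarith
  ultimately show ?thesis by (simp add: algebra_simps)
qed

text \<open>The actual root colour is always allowed, so forcing it means excluding every other
  colour, each through some child.\<close>

lemma forced_iff_all_colours_forced:
  assumes "x \<in> rooted_colourings b q (Suc h) c"
  shows "x \<in> forced_colourings b q (Suc h) c
    \<longleftrightarrow> (\<forall>d\<in>{..<q} - {c}. \<exists>i<b. branch b h i x \<in> forced_colourings b q h d)"
proof -
  have x: "x \<in> tree_colourings b q (Suc h)" "x [] = c"
    using assms by (auto simp: rooted_colourings_def)
  note c = root_in_allowed[OF x(1), unfolded x(2)]
  have "x \<in> forced_colourings b q (Suc h) c \<longleftrightarrow> allowed b q (Suc h) x \<subseteq> {c}"
    using x c unfolding forced_colourings_def by blast
  also have "\<dots> \<longleftrightarrow> (\<forall>d\<in>{..<q} - {c}. \<exists>i<b. allowed b q h (branch b h i x) = {d})"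
    unfolding allowed_Suc_branch by blast
  also have "\<dots> \<longleftrightarrow> (\<forall>d\<in>{..<q} - {c}. \<exists>i<b. branch b h i x \<in> forced_colourings b q h d)"
    by (simp add: forced_colourings_def branch_in_tree_colourings(1)[OF x(1)] cong: conj_cong)
  finally show ?thesis .
qed

lemma real_card_le_sum_cover:
  assumes "S \<subseteq> (\<Union>i\<in>I. U i)" "finite I" "\<And>i. i \<in> I \<Longrightarrow> finite (U i)"
  shows "real (card S) \<le> (\<Sum>i\<in>I. real (card (U i)))"
proof -
  have "card S \<le> card (\<Union>i\<in>I. U i)"
    using assms by (intro card_mono) auto
  also have "\<dots> \<le> (\<Sum>i\<in>I. card (U i))"
    by (rule card_UN_le[OF assms(2)])
  finally show ?thesis
    by (simp only: of_nat_le_iff flip: of_nat_sum)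
qed

text \<open>Induction on the height with the fraction 2/3 as invariant. If the root is not forced,
  some other colour \<open>d\<close> is forced at none of the \<open>b\<close> independent branches.
  By the induction hypothesis a single branch fails with probability at most
  \<open>(q - 1 - 2/3) / (q - 1)\<close>, and \<open>small\<close> says that the union bound over
  the \<open>q - 1\<close> colours \<open>d\<close> stays below 1/3.\<close>

lemma card_forced_colourings:
  assumes small: "(real q - 1) * (real q - 1 - 2/3) ^ b \<le> (real q - 1) ^ b / 3"
    and q: "q \<ge> 3"
  shows "c < q \<Longrightarrow> 3 * card (forced_colourings b q h c) \<ge> 2 * num_rooted b q h"
proof (induction h arbitrary: c)
  case 0
  \<comment> \<open>At height 0 the root is itself a leaf, so every colouring is forced.\<close>
  have "forced_colourings b q 0 c = rooted_colourings b q 0 c"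
    by (auto simp: forced_colourings_def rooted_colourings_def)
  then show ?case using 0 card_rooted_colourings[of c q b 0] by simp
next
  case (Suc h)
  let ?N = "real (num_rooted b q h)"
  let ?R = "rooted_colourings b q (Suc h) c"
  let ?U = "\<lambda>d. {x \<in> ?R. \<forall>i<b. branch b h i x \<in> unforced_branches b q h c d}"
  have "?R - forced_colourings b q (Suc h) c \<subseteq> (\<Union>d\<in>{..<q} - {c}. ?U d)"
  proof
    fix x assume x: "x \<in> ?R - forced_colourings b q (Suc h) c"
    then have x': "x \<in> tree_colourings b q (Suc h)" "x [] = c"
      by (auto simp: rooted_colourings_def)
    obtain d where "d \<in> {..<q} - {c}" "\<forall>i<b. branch b h i x \<notin> forced_colourings b q h d"
      using x forced_iff_all_colours_forced[of x b q h c] by blast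
    then show "x \<in> (\<Union>d\<in>{..<q} - {c}. ?U d)"
      using x branch_in_tree_colourings[OF x'(1)] x'(2) by (auto simp: unforced_branches_def)
  qed
  then have "real (card (?R - forced_colourings b q (Suc h) c)) \<le> (\<Sum>d\<in>{..<q} - {c}. real (card (?U d)))"
    by (rule real_card_le_sum_cover) simp_all
  also have "\<dots> \<le> (\<Sum>d\<in>{..<q} - {c}. ((real q - 1 - 2/3) * ?N) ^ b)"
  proof (rule sum_mono)
    fix d assume d: "d \<in> {..<q} - {c}"
    have "card (?U d) = (\<Prod>i<b. card (unforced_branches b q h c d))"
      by (rule card_rooted_branches[OF Suc.prems, where A = "\<lambda>_. unforced_branches b q h c d"])
        (auto simp: unforced_branches_def)
    then have "card (?U d) = card (unforced_branches b q h c d) ^ b" by simp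
    moreover have "real (card (unforced_branches b q h c d)) \<le> (real q - 1 - 2/3) * ?N"
      using card_unforced_branches[OF Suc.prems, of d b h] d Suc.IH[of d] by blast
    ultimately show "real (card (?U d)) \<le> ((real q - 1 - 2/3) * ?N) ^ b"
      by (simp add: power_mono)
  qed
  also have "\<dots> = (real q - 1) * (real q - 1 - 2/3) ^ b * ?N ^ b"
    using Suc.prems by (simp add: power_mult_distrib of_nat_diff)
  also have "\<dots> \<le> (real q - 1) ^ b / 3 * ?N ^ b"
    by (intro mult_right_mono small) auto
  also have "\<dots> = real (num_rooted b q (Suc h)) / 3"
    using q by (simp add: power_mult_distrib of_nat_diff)
  finally have "3 * real (card (?R - forced_colourings b q (Suc h) c)) \<le> num_rooted b q (Suc h)"
    by simp
  moreover have "card (?R - forced_colourings b q (Suc h) c) + card (forced_colourings b q (Suc h) c)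
      = num_rooted b q (Suc h)"
    using card_mono[OF finite_rooted_colourings forced_subset_rooted, of b q "Suc h" c]
    by (simp only: card_Diff_subset[OF finite_forced_colourings forced_subset_rooted]
      card_rooted_colourings[OF Suc.prems])
  ultimately show ?case by linarith
qed

section \<open>Pivotal leaves\<close>

text \<open>Recolouring \<open>l\<close> alone may change what the leaves allow at the root. Any
  change of the allowed set counts, not only leaving the forced colourings; in this form the
  property passes down to branches.\<close>

definition pivotal :: "nat \<Rightarrow> nat \<Rightarrow> nat \<Rightarrow> nat list \<Rightarrow> (nat list \<Rightarrow> nat) set" where
  "pivotal b q h l = {x \<in> tree_colourings b q h.
     \<exists>a. x(l := a) \<in> tree_colourings b q h \<and> allowed b q h (x(l := a)) \<noteq> allowed b q h x}"

lemma branch_update: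
  "branch b h i (x(j # l := a)) = (if i = j \<and> l \<in> tree_verts b h then (branch b h i x)(l := a) else branch b h i x)"
  by (auto simp: branch_def fun_eq_iff)

text \<open>A change at the root must come through the one branch containing the leaf. The other
  branches stay the same, so if they already forced all colours other than that of the root, the
  root would be forced both before and after.\<close>

lemma pivotal_branches:
  assumes "x \<in> pivotal b q (Suc h) (i # l)" "i < b"
  shows "branch b h i x \<in> pivotal b q h l"
    and "\<exists>d\<in>{..<q} - {x []}. \<forall>j<b. j \<noteq> i \<longrightarrow> branch b h j x \<in> unforced_branches b q h (x []) d"
proof -
  from assms obtain a where x: "x \<in> tree_colourings b q (Suc h)"
    and xa: "x(i # l := a) \<in> tree_colourings b q (Suc h)"
    and ne: "allowed b q (Suc h) (x(i # l := a)) \<noteq> allowed b q (Suc h) x"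
    unfolding pivotal_def by auto
  let ?y = "x(i # l := a)"
  have other: "branch b h j ?y = branch b h j x" if "j \<noteq> i" for j
    using that by (simp add: branch_update)
  have ne': "allowed b q h (branch b h i ?y) \<noteq> allowed b q h (branch b h i x)"
  proof
    assume "allowed b q h (branch b h i ?y) = allowed b q h (branch b h i x)"
    then have "allowed b q h (branch b h j ?y) = allowed b q h (branch b h j x)" for j
      using other by (cases "j = i") auto
    then show False using ne unfolding allowed_Suc_branch by simp
  qed
  \<comment> \<open>As the branch did change, \<open>l\<close> must lie in the subtree, which
    excludes the trivial case of \<open>branch_update\<close>.\<close>
  then have l: "branch b h i ?y = (branch b h i x)(l := a)"
    by (auto simp: branch_update split: if_splits)
  show "branch b h i x \<in> pivotal b q h l"
    using ne' branch_in_tree_colourings(1)[OF x assms(2)] branch_in_tree_colourings(1)[OF xa assms(2)]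
    unfolding pivotal_def l by blast
  show "\<exists>d\<in>{..<q} - {x []}. \<forall>j<b. j \<noteq> i \<longrightarrow> branch b h j x \<in> unforced_branches b q h (x []) d"
  proof (rule ccontr)
    assume "\<not> ?thesis"
    then have *: "\<forall>d\<in>{..<q} - {x []}. \<exists>j<b. j \<noteq> i \<and> branch b h j x \<in> forced_colourings b q h d"
      using branch_in_tree_colourings[OF x] unfolding unforced_branches_def by blast
    have "x \<in> forced_colourings b q (Suc h) (x [])"
      using * x forced_iff_all_colours_forced[of x b q h "x []"]
      by (auto simp: rooted_colourings_def)
    moreover have "?y \<in> forced_colourings b q (Suc h) (x [])"
    proof -
      have "?y \<in> rooted_colourings b q (Suc h) (x [])"
        using xa by (simp add: rooted_colourings_def)
      moreover have "\<forall>d\<in>{..<q} - {x []}. \<exists>j<b. branch b h j ?y \<in> forced_colourings b q h d"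
        using * other by metis
      ultimately show ?thesis using forced_iff_all_colours_forced by blast
    qed
    ultimately show False using ne by (simp add: forced_colourings_def)
  qed
qed

text \<open>Each level of the path from the leaf to the root costs a factor \<rho>: besides the
  branch on the path being pivotal, the other \<open>b - 1\<close> branches must all fail to force
  some common colour \<open>d\<close>. These events are independent given the root colour.\<close>

lemma card_pivotal:
  assumes small: "(real q - 1) * (real q - 1 - 2/3) ^ b \<le> (real q - 1) ^ b / 3"
    and rho: "(real q - 1) * (real q - 1 - 2/3) ^ (b - 1) \<le> \<rho> * (real q - 1) ^ (b - 1)"
    and q: "q \<ge> 3" and "\<rho> \<ge> 0"
  shows "c < q \<Longrightarrow> set l \<subseteq> {..<b} \<Longrightarrow> length l = h \<Longrightarrow>
    real (card (rooted_colourings b q h c \<inter> pivotal b q h l)) \<le> \<rho> ^ h * num_rooted b q h"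
proof (induction h arbitrary: c l)
  case 0
  have "card (rooted_colourings b q 0 c \<inter> pivotal b q 0 l) \<le> card (rooted_colourings b q 0 c)"
    by (intro card_mono) auto
  then show ?case using 0 card_rooted_colourings[of c q b 0] by simp
next
  case (Suc h)
  obtain i l' where l: "l = i # l'" using Suc.prems by (cases l) auto
  have i: "i < b" and l': "set l' \<subseteq> {..<b}" "length l' = h" using Suc.prems l by auto
  let ?N = "real (num_rooted b q h)"
  let ?R = "rooted_colourings b q (Suc h) c"
  let ?P = "{y \<in> tree_colourings b q h. y [] \<noteq> c \<and> y \<in> pivotal b q h l'}"
  let ?A = "\<lambda>d j. if j = i then ?P else unforced_branches b q h c d"
  let ?U = "\<lambda>d. {x \<in> ?R. \<forall>j<b. branch b h j x \<in> ?A d j}"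
  have P: "real (card ?P) \<le> (real q - 1) * (\<rho> ^ h * ?N)"
  proof -
    have "real (card ?P) = (\<Sum>d\<in>{..<q} - {c}. real (card (rooted_colourings b q h d \<inter> pivotal b q h l')))"
      by (subst card_tree_colourings_split) (auto simp: pivotal_def tree_colouring_root)
    also have "\<dots> \<le> (\<Sum>d\<in>{..<q} - {c}. \<rho> ^ h * ?N)"
      using Suc.IH l' by (intro sum_mono) auto
    also have "\<dots> = (real q - 1) * (\<rho> ^ h * ?N)"
      using Suc.prems by (simp add: of_nat_diff)
    finally show ?thesis .
  qed
  have "?R \<inter> pivotal b q (Suc h) l \<subseteq> (\<Union>d\<in>{..<q} - {c}. ?U d)"
  proof
    fix x assume x: "x \<in> ?R \<inter> pivotal b q (Suc h) l"
    then have x': "x \<in> tree_colourings b q (Suc h)" "x [] = c"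
      by (auto simp: rooted_colourings_def)
    have "x \<in> pivotal b q (Suc h) (i # l')" using x l by simp
    from pivotal_branches[OF this i] obtain d where "branch b h i x \<in> pivotal b q h l'"
      "d \<in> {..<q} - {c}" "\<forall>j<b. j \<noteq> i \<longrightarrow> branch b h j x \<in> unforced_branches b q h c d"
      using x'(2) by blast
    moreover have "branch b h i x \<in> tree_colourings b q h" "branch b h i x [] \<noteq> c"
      using branch_in_tree_colourings[OF x'(1) i] x'(2) by auto
    ultimately show "x \<in> (\<Union>d\<in>{..<q} - {c}. ?U d)" using x by auto
  qed
  then have "real (card (?R \<inter> pivotal b q (Suc h) l)) \<le> (\<Sum>d\<in>{..<q} - {c}. real (card (?U d)))"
    by (rule real_card_le_sum_cover) simp_all
  also have "\<dots> \<le> (\<Sum>d\<in>{..<q} - {c}. (real q - 1) * (\<rho> ^ h * ?N) * ((real q - 1 - 2/3) * ?N) ^ (b - 1))"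
  proof (rule sum_mono)
    fix d assume d: "d \<in> {..<q} - {c}"
    have "card (?U d) = (\<Prod>j<b. card (?A d j))"
      by (rule card_rooted_branches[OF Suc.prems(1), where A = "?A d"]) (auto simp: unforced_branches_def)
    also have "\<dots> = card ?P * card (unforced_branches b q h c d) ^ (b - 1)"
      using i by (subst prod.remove[of _ i]) auto
    finally have "real (card (?U d)) = real (card ?P) * real (card (unforced_branches b q h c d)) ^ (b - 1)"
      by simp
    also have "\<dots> \<le> (real q - 1) * (\<rho> ^ h * ?N) * ((real q - 1 - 2/3) * ?N) ^ (b - 1)"
      using P card_unforced_branches[OF Suc.prems(1), of d b h] d q \<open>\<rho> \<ge> 0\<close>
        card_forced_colourings[OF small q, of d h]
      by (intro mult_mono power_mono) auto
    finally show "real (card (?U d)) \<le> \<dots>" .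
  qed
  \<comment> \<open>One factor \<open>q - 1\<close> counts the colours \<open>d\<close> and is
    absorbed into \<rho>. The other counts the root colours of the branch on the path and later
    completes the \<open>b\<close>-th power in \<open>num_rooted\<close>.\<close>
  also have "\<dots> = (real q - 1) * (\<rho> ^ h * ?N) * ?N ^ (b - 1) * ((real q - 1) * (real q - 1 - 2/3) ^ (b - 1))"
    using Suc.prems by (simp add: power_mult_distrib of_nat_diff)
  also have "\<dots> \<le> (real q - 1) * (\<rho> ^ h * ?N) * ?N ^ (b - 1) * (\<rho> * (real q - 1) ^ (b - 1))"
    using q \<open>\<rho> \<ge> 0\<close> by (intro mult_left_mono rho) auto
  also have "\<dots> = \<rho> ^ Suc h * ((real q - 1) * ?N) ^ Suc (b - 1)"
    by (simp add: power_mult_distrib)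
  also have "\<dots> = \<rho> ^ Suc h * real (num_rooted b q (Suc h))"
    using q i by (simp add: of_nat_diff)
  finally show ?case .
qed

section \<open>A bottleneck bound for the mixing time\<close>

lemma measure_bind_pmf_eq_sum:
  assumes "finite A" "set_pmf M \<subseteq> A"
  shows "measure_pmf.prob (bind_pmf M N) X = (\<Sum>x\<in>A. pmf M x * measure_pmf.prob (N x) X)"
proof -
  have "measure_pmf.prob (bind_pmf M N) X = (\<integral>x. measure_pmf.prob (N x) X \<partial>measure_pmf M)"
    unfolding measure_pmf_bind
    by (rule measure_pmf.measure_bind[where N = "count_space UNIV"]) (auto simp: measure_subprob)
  also have "\<dots> = (\<Sum>x\<in>A. measure_pmf.prob (N x) X * pmf M x)"
    using assms by (intro integral_measure_pmf_real) auto
  finally show ?thesis by (simp add: mult.commute)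
qed

text \<open>Running the chain from \<mu> is the same as drawing a starting state from \<mu> first;
  this links the uniform start on \<open>S\<close> to single starts.\<close>

lemma funpow_bind_pmf_mixture:
  "((\<lambda>\<mu>. bind_pmf \<mu> K) ^^ t) \<mu> = bind_pmf \<mu> (chain_dist K t)"
  by (induction t) (simp_all add: chain_dist_def bind_return_pmf' bind_assoc_pmf)

text \<open>Symmetry of the kernel makes its columns sum to 1, so a law bounded pointwise by
  \<open>1 / card S\<close> remains so bounded. Hence each step carries at most \<Phi> of new mass
  out of \<open>S\<close>.\<close>

lemma escape_probability_from_uniform:
  fixes K :: "'s \<Rightarrow> 's pmf" and \<Phi> :: real
  assumes fin: "finite \<Omega>" and S: "S \<subseteq> \<Omega>" "S \<noteq> {}"
    and closed: "\<And>x. x \<in> \<Omega> \<Longrightarrow> set_pmf (K x) \<subseteq> \<Omega>"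
    and sym: "\<And>x y. x \<in> \<Omega> \<Longrightarrow> y \<in> \<Omega> \<Longrightarrow> pmf (K x) y = pmf (K y) x"
    and flow: "(\<Sum>x\<in>S. measure_pmf.prob (K x) (- S)) \<le> \<Phi> * card S"
  shows "measure_pmf.prob (((\<lambda>\<mu>. bind_pmf \<mu> K) ^^ t) (pmf_of_set S)) (- S) \<le> t * \<Phi>"
proof -
  define \<mu> where "\<mu> t = ((\<lambda>\<mu>. bind_pmf \<mu> K) ^^ t) (pmf_of_set S)" for t
  have finS: "finite S" using S fin finite_subset by blast
  have \<mu>0: "\<mu> 0 = pmf_of_set S" and \<mu>Suc: "\<mu> (Suc t) = bind_pmf (\<mu> t) K" for t
    by (simp_all add: \<mu>_def)
  have supp: "set_pmf (\<mu> t) \<subseteq> \<Omega>" for t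
    using S finS closed by (induction t) (auto simp: \<mu>0 \<mu>Suc)
  have dom: "y \<in> \<Omega> \<Longrightarrow> pmf (\<mu> t) y \<le> 1 / card S" for t y
  proof (induction t arbitrary: y)
    case 0
    then show ?case using finS S by (simp add: \<mu>0 indicator_def)
  next
    case (Suc t)
    have "pmf (\<mu> (Suc t)) y = (\<Sum>x\<in>\<Omega>. pmf (\<mu> t) x * pmf (K x) y)"
      using measure_bind_pmf_eq_sum[OF fin supp, of t K "{y}"] by (simp add: \<mu>Suc measure_pmf_single)
    also have "\<dots> \<le> (\<Sum>x\<in>\<Omega>. 1 / card S * pmf (K x) y)"
      by (intro sum_mono mult_right_mono Suc.IH) auto
    also have "\<dots> = 1 / card S * (\<Sum>x\<in>\<Omega>. pmf (K y) x)"
      using sym[OF _ Suc.prems] by (simp add: sum_distrib_left)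
    also have "(\<Sum>x\<in>\<Omega>. pmf (K y) x) = 1"
      by (rule sum_pmf_eq_1[OF fin closed[OF Suc.prems]])
    finally show ?case by simp
  qed
  have "measure_pmf.prob (\<mu> t) (- S) \<le> t * \<Phi>"
  proof (induction t)
    case 0
    then show ?case using finS S by (simp add: \<mu>0 measure_pmf_of_set)
  next
    case (Suc t)
    have "measure_pmf.prob (\<mu> (Suc t)) (- S) = (\<Sum>x\<in>\<Omega>. pmf (\<mu> t) x * measure_pmf.prob (K x) (- S))"
      unfolding \<mu>Suc by (rule measure_bind_pmf_eq_sum[OF fin supp])
    also have "\<dots> = (\<Sum>x\<in>S. pmf (\<mu> t) x * measure_pmf.prob (K x) (- S))
        + (\<Sum>x\<in>\<Omega> - S. pmf (\<mu> t) x * measure_pmf.prob (K x) (- S))"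
      using sum.subset_diff[OF S(1) fin] by (simp add: add.commute)
    also have "(\<Sum>x\<in>S. pmf (\<mu> t) x * measure_pmf.prob (K x) (- S))
        \<le> (\<Sum>x\<in>S. 1 / card S * measure_pmf.prob (K x) (- S))"
      using S(1) by (intro sum_mono mult_right_mono dom) auto
    also have "\<dots> \<le> \<Phi>"
      using flow finS S(2) by (simp add: sum_divide_distrib[symmetric] divide_le_eq card_gt_0_iff)
    \<comment> \<open>Mass already outside \<open>S\<close> is counted in full, with no credit for
      what returns.\<close>
    also have "(\<Sum>x\<in>\<Omega> - S. pmf (\<mu> t) x * measure_pmf.prob (K x) (- S)) \<le> (\<Sum>x\<in>\<Omega> - S. pmf (\<mu> t) x)"
      by (intro sum_mono mult_left_le) auto
    also have "\<dots> = measure_pmf.prob (\<mu> t) (\<Omega> - S)"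
      using fin by (simp add: measure_measure_pmf_finite)
    also have "\<dots> \<le> measure_pmf.prob (\<mu> t) (- S)"
      by (rule measure_pmf.finite_measure_mono) auto
    also have "\<dots> \<le> t * \<Phi>" by (rule Suc.IH)
    finally show ?case by (simp add: algebra_simps)
  qed
  then show ?thesis unfolding \<mu>_def .
qed

text \<open>The uniform start on \<open>S\<close> averages over single starts, so some state of
  \<open>S\<close>, depending on \<open>t\<close>, escapes no more often than the average.\<close>

lemma exists_slow_start:
  fixes K :: "'s \<Rightarrow> 's pmf" and \<Phi> :: real
  assumes fin: "finite \<Omega>" and S: "S \<subseteq> \<Omega>" "S \<noteq> {}"
    and closed: "\<And>x. x \<in> \<Omega> \<Longrightarrow> set_pmf (K x) \<subseteq> \<Omega>"
    and sym: "\<And>x y. x \<in> \<Omega> \<Longrightarrow> y \<in> \<Omega> \<Longrightarrow> pmf (K x) y = pmf (K y) x"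
    and flow: "(\<Sum>x\<in>S. measure_pmf.prob (K x) (- S)) \<le> \<Phi> * card S"
  shows "\<exists>x\<in>S. measure_pmf.prob (chain_dist K t x) S \<ge> 1 - t * \<Phi>"
proof (rule ccontr)
  have finS: "finite S" using S fin finite_subset by blast
  assume "\<not> ?thesis"
  then have less: "t * \<Phi> < measure_pmf.prob (chain_dist K t x) (- S)" if "x \<in> S" for x
    using that measure_pmf.prob_compl[of S "chain_dist K t x"] by (force simp: Compl_eq_Diff_UNIV)
  have "t * \<Phi> * card S < (\<Sum>x\<in>S. measure_pmf.prob (chain_dist K t x) (- S))"
    using sum_strict_mono[OF finS S(2) less] by (simp add: mult.commute)
  also have "\<dots> = card S * measure_pmf.prob (bind_pmf (pmf_of_set S) (chain_dist K t)) (- S)"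
    using finS S(2) by (simp add: measure_bind_pmf_eq_sum[OF finS] sum_distrib_left)
  also have "\<dots> \<le> card S * (t * \<Phi>)"
    using escape_probability_from_uniform[OF assms, of t]
    by (intro mult_left_mono) (auto simp: funpow_bind_pmf_mixture)
  finally show False by (simp add: mult.commute)
qed

section \<open>Total variation distance and mixing time\<close>

lemma tv_dist_ge:
  assumes "finite \<Omega>" "A \<subseteq> \<Omega>"
  shows "measure_pmf.prob \<theta>1 A - measure_pmf.prob \<theta>2 A \<le> tv_dist \<Omega> \<theta>1 \<theta>2"
proof -
  have "\<bar>measure_pmf.prob \<theta>1 A - measure_pmf.prob \<theta>2 A\<bar> \<le> tv_dist \<Omega> \<theta>1 \<theta>2"
    unfolding tv_dist_def using assms by (intro Max_ge) auto
  then show ?thesis by linarith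
qed

text \<open>A finite maximum bounds the infimum for each start. So the set of admissible times is
  nonempty, its least element is attained, and the condition there extends to every later time, in
  particular to \<open>t\<close>.\<close>

lemma mixing_time_eq_enatD:
  assumes "finite \<Omega>" "mixing_time \<Omega> K \<pi> \<delta> = enat t" "x \<in> \<Omega>"
  shows "t > 0" "tv_dist \<Omega> (chain_dist K t x) \<pi> \<le> \<delta>"
proof -
  define T where "T = {t. t > 0 \<and> (\<forall>t'\<ge>t. tv_dist \<Omega> (chain_dist K t' x) \<pi> \<le> \<delta>)}"
  have le: "Inf (enat ` T) \<le> enat t"
    using assms by (auto simp: T_def mixing_time_def mixing_time_from_def intro!: Max_ge simp flip: assms(2))
  then have "T \<noteq> {}" by (auto simp: Inf_enat_def)
  then have "Inf (enat ` T) \<in> enat ` T"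
    unfolding Inf_enat_def by (auto intro: LeastI)
  then obtain t0 where "t0 \<in> T" "t0 \<le> t" using le by auto
  then show "t > 0" "tv_dist \<Omega> (chain_dist K t x) \<pi> \<le> \<delta>" by (auto simp: T_def)
qed

lemma mixing_time_ge_1:
  assumes "finite \<Omega>" "\<Omega> \<noteq> {}"
  shows "1 \<le> ereal_of_enat (mixing_time \<Omega> K \<pi> \<delta>)"
proof (cases "mixing_time \<Omega> K \<pi> \<delta>")
  case (enat t)
  then show ?thesis
    using mixing_time_eq_enatD(1)[OF assms(1) enat] assms(2) by fastforce
qed simp

text \<open>At the mixing time \<open>t\<close>, a slow start has mass at least
  \<open>1 - t * \<Phi>\<close> on \<open>S\<close>, whereas the uniform law has
  \<open>card S / card \<Omega>\<close>. These may differ by at most \<delta>. An infinite mixing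
  time meets any bound.\<close>

lemma mixing_time_ge_bottleneck:
  fixes K :: "'s \<Rightarrow> 's pmf" and \<Phi> :: real
  assumes fin: "finite \<Omega>" and S: "S \<subseteq> \<Omega>" "S \<noteq> {}"
    and closed: "\<And>x. x \<in> \<Omega> \<Longrightarrow> set_pmf (K x) \<subseteq> \<Omega>"
    and sym: "\<And>x y. x \<in> \<Omega> \<Longrightarrow> y \<in> \<Omega> \<Longrightarrow> pmf (K x) y = pmf (K y) x"
    and flow: "(\<Sum>x\<in>S. measure_pmf.prob (K x) (- S)) \<le> \<Phi> * card S"
    and "\<Phi> > 0"
  shows "ereal ((1 - card S / card \<Omega> - \<delta>) / \<Phi>)
    \<le> ereal_of_enat (mixing_time \<Omega> K (pmf_of_set \<Omega>) \<delta>)"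
proof (cases "mixing_time \<Omega> K (pmf_of_set \<Omega>) \<delta>")
  case (enat t)
  obtain x where x: "x \<in> S" "measure_pmf.prob (chain_dist K t x) S \<ge> 1 - t * \<Phi>"
    using exists_slow_start[OF fin S closed sym flow] by blast
  have "\<Omega> \<noteq> {}" using S by auto
  then have "measure_pmf.prob (pmf_of_set \<Omega>) S = card S / card \<Omega>"
    using fin S(1) by (simp add: measure_pmf_of_set Int_absorb1)
  then have "1 - t * \<Phi> - card S / card \<Omega> \<le> tv_dist \<Omega> (chain_dist K t x) (pmf_of_set \<Omega>)"
    using tv_dist_ge[OF fin S(1), of "chain_dist K t x" "pmf_of_set \<Omega>"] x(2) by linarith
  also have "\<dots> \<le> \<delta>"
    using x(1) S(1) by (intro mixing_time_eq_enatD(2)[OF fin enat]) auto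
  finally show ?thesis
    using \<open>\<Phi> > 0\<close> enat by (simp add: divide_le_eq)
qed simp

section \<open>Glauber dynamics\<close>

lemma prob_glauber_step:
  assumes "finite V" "V \<noteq> {}" "q > 0"
  shows "measure_pmf.prob (glauber_step V adj q x) A = (\<Sum>v\<in>V. \<Sum>c<q.
    indicator A (if x(v := c) \<in> proper_colourings V adj q then x(v := c) else x)) / (card V * q)"
  using assms unfolding glauber_step_def
  by (simp add: measure_bind_pmf_eq_sum[OF assms(1)] measure_bind_pmf_eq_sum[of "{..<q}"]
      measure_return_pmf lessThan_empty_iff sum_divide_distrib mult.commute[of "real q"])

lemma set_pmf_glauber_step:
  assumes "finite V" "V \<noteq> {}" "q > 0" "x \<in> proper_colourings V adj q"
  shows "set_pmf (glauber_step V adj q x) \<subseteq> proper_colourings V adj q"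
  using assms unfolding glauber_step_def by (auto simp: lessThan_empty_iff split: if_splits)

text \<open>Between distinct proper colourings, a move at \<open>v\<close> needs agreement off
  \<open>v\<close> and the single proposal \<open>y v\<close>. The number of such \<open>v\<close>
  is symmetric in the two colourings.\<close>

lemma pmf_glauber_step_symmetric:
  assumes V: "finite V" "V \<noteq> {}" "q > 0"
    and x: "x \<in> proper_colourings V adj q" and y: "y \<in> proper_colourings V adj q"
  shows "pmf (glauber_step V adj q x) y = pmf (glauber_step V adj q y) x"
proof (cases "x = y")
  case False
  have *: "pmf (glauber_step V adj q x) y = (\<Sum>v\<in>V. of_bool (\<forall>u. u \<noteq> v \<longrightarrow> x u = y u)) / (card V * q)"
    if x: "x \<in> proper_colourings V adj q" and y: "y \<in> proper_colourings V adj q" and "x \<noteq> y" for x y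
  proof -
    have "(\<Sum>c<q. indicator {y} (if x(v := c) \<in> proper_colourings V adj q then x(v := c) else x))
       = (of_bool (\<forall>u. u \<noteq> v \<longrightarrow> x u = y u) :: real)" if "v \<in> V" for v
    proof -
      have yv: "y v \<in> {..<q}" using y \<open>v \<in> V\<close> by (auto simp: proper_colourings_def PiE_iff)
      have "indicator {y} (if x(v := c) \<in> proper_colourings V adj q then x(v := c) else x)
          = (if c = y v then of_bool (\<forall>u. u \<noteq> v \<longrightarrow> x u = y u) else 0 :: real)" for c
      proof -
        have "x(v := c) = y \<longleftrightarrow> c = y v \<and> (\<forall>u. u \<noteq> v \<longrightarrow> x u = y u)"
          by (auto simp: fun_eq_iff)
        \<comment> \<open>A rejected proposal stays at \<open>x\<close>, which is not
          \<open>y\<close>; a proposal equal to \<open>y\<close> is always accepted.\<close>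
        moreover have "(if x(v := c) \<in> proper_colourings V adj q then x(v := c) else x) = y
            \<longleftrightarrow> x(v := c) = y"
          using y \<open>x \<noteq> y\<close> by (cases "x(v := c) \<in> proper_colourings V adj q") metis+
        ultimately show ?thesis by (simp add: indicator_def)
      qed
      then show ?thesis using yv by simp
    qed
    then show ?thesis
      using prob_glauber_step[OF V, of adj x "{y}"] by (simp add: measure_pmf_single cong: sum.cong)
  qed
  have "(\<forall>u. u \<noteq> v \<longrightarrow> x u = y u) \<longleftrightarrow> (\<forall>u. u \<noteq> v \<longrightarrow> y u = x u)" for v
    by auto
  then show ?thesis using *[OF x y False] *[OF y x] False by simp
qed simp

text \<open>Rejected moves stay in \<open>S\<close>, so leaving requires choosing a vertex of
  \<open>W\<close>, whatever the colour.\<close>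

lemma prob_glauber_step_escape:
  assumes V: "finite V" "V \<noteq> {}" "q > 0" and "x \<in> S" "W \<subseteq> V"
    and W: "\<And>v c. v \<in> V \<Longrightarrow> x(v := c) \<in> proper_colourings V adj q \<Longrightarrow> x(v := c) \<notin> S \<Longrightarrow> v \<in> W"
  shows "measure_pmf.prob (glauber_step V adj q x) (- S) \<le> card W / card V"
proof -
  let ?s = "\<lambda>v c. if x(v := c) \<in> proper_colourings V adj q then x(v := c) else x"
  have "(\<Sum>v\<in>V. \<Sum>c<q. indicator (- S) (?s v c)) \<le> (\<Sum>v\<in>V. \<Sum>c<q. indicator W v :: real)"
    using \<open>x \<in> S\<close> W by (intro sum_mono) (auto simp: indicator_def)
  also have "\<dots> = real q * (\<Sum>v\<in>V. indicator W v :: real)"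
    by (simp add: sum_distrib_left)
  also have "(\<Sum>v\<in>V. indicator W v :: real) = (\<Sum>v\<in>W. 1)"
    using V(1) \<open>W \<subseteq> V\<close> by (intro sum.mono_neutral_cong_right) auto
  finally have "(\<Sum>v\<in>V. \<Sum>c<q. indicator (- S) (?s v c)) / (card V * q)
      \<le> real q * (\<Sum>v\<in>W. 1) / (card V * q)"
    by (rule divide_right_mono) simp
  also have "\<dots> = card W / card V"
    using V(3) by simp
  finally show ?thesis
    unfolding prob_glauber_step[OF V] .
qed

section \<open>The dynamics on the tree\<close>

lemma card_tree_colourings: "card (tree_colourings b q h) = q * num_rooted b q h"
proof -
  have "tree_colourings b q h = (\<Union>d<q. rooted_colourings b q h d)"
    using tree_colouring_root by (auto simp: rooted_colourings_def)
  then have "card (tree_colourings b q h) = (\<Sum>d<q. card (rooted_colourings b q h d))"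
    by (simp only:) (rule card_UN_disjoint, auto simp: rooted_colourings_def)
  then show ?thesis by (simp add: card_rooted_colourings)
qed

lemma num_rooted_pos: "q \<ge> 3 \<Longrightarrow> num_rooted b q h > 0"
  by (induction h) auto

text \<open>All \<open>q \<ge> 3\<close> root colours are equally frequent. This is the source of
  the constant 2/3 in the mixing bounds.\<close>

lemma root_fraction_le:
  assumes "q \<ge> 3" "S \<subseteq> rooted_colourings b q h c" "c < q"
  shows "card S / card (tree_colourings b q h) \<le> 1 / 3"
proof -
  have "card S \<le> num_rooted b q h"
    using card_mono[OF finite_rooted_colourings assms(2)] card_rooted_colourings[OF assms(3)] by simp
  then have "3 * card S \<le> q * num_rooted b q h"
    using assms(1) by (intro mult_mono) auto
  then have "3 * real (card S) \<le> real (q * num_rooted b q h)"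
    by linarith
  then show ?thesis
    using num_rooted_pos[OF assms(1), of b h] assms(1)
    unfolding card_tree_colourings by (simp add: divide_le_eq)
qed

lemma tree_glauber_bottleneck:
  fixes \<Phi> \<delta> :: real
  assumes q: "q \<ge> 3" "c < q" and S: "S \<subseteq> rooted_colourings b q H c" "S \<noteq> {}"
    and flow: "(\<Sum>x\<in>S. measure_pmf.prob (glauber_step (tree_verts b H) tree_adj q x) (- S)) \<le> \<Phi> * card S"
    and "\<Phi> > 0"
  shows "ereal ((2 / 3 - \<delta>) / \<Phi>) \<le> ereal_of_enat (tree_glauber_mixing_time b H q \<delta>)"
proof -
  let ?V = "tree_verts b H" and ?\<Omega> = "tree_colourings b q H"
  have V: "finite ?V" "?V \<noteq> {}" "q > 0"
    using q finite_tree_verts by auto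
  have "ereal ((1 - card S / card ?\<Omega> - \<delta>) / \<Phi>) \<le>
      ereal_of_enat (mixing_time ?\<Omega> (glauber_step ?V tree_adj q) (pmf_of_set ?\<Omega>) \<delta>)"
  proof (rule mixing_time_ge_bottleneck[OF finite_tree_colourings _ S(2) _ _ flow \<open>\<Phi> > 0\<close>])
    show "S \<subseteq> ?\<Omega>" using S(1) rooted_subset_tree_colourings by blast
  qed (simp_all add: tree_colourings_def set_pmf_glauber_step[OF V] pmf_glauber_step_symmetric[OF V])
  moreover have "(2 / 3 - \<delta>) / \<Phi> \<le> (1 - card S / card ?\<Omega> - \<delta>) / \<Phi>"
    using root_fraction_le[OF q(1) S(1) q(2)] \<open>\<Phi> > 0\<close> by (intro divide_right_mono) auto
  ultimately show ?thesis
    unfolding tree_glauber_mixing_time_def Let_def tree_colourings_def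
    by (meson ereal_less_eq(3) order.trans)
qed

text \<open>The set of colourings with root colour 0 is left only when the root is chosen, which has
  probability \<open>1 / card (tree_verts b H)\<close> per step.\<close>

lemma mixing_time_ge_size:
  assumes "q \<ge> 3"
  shows "ereal ((2 / 3 - \<delta>) * card (tree_verts b H)) \<le> ereal_of_enat (tree_glauber_mixing_time b H q \<delta>)"
proof -
  let ?V = "tree_verts b H" and ?S = "rooted_colourings b q H 0"
  have V: "finite ?V" "?V \<noteq> {}" "q > 0"
    using assms finite_tree_verts by auto
  have "measure_pmf.prob (glauber_step ?V tree_adj q x) (- ?S) \<le> card {[] :: nat list} / card ?V"
    if "x \<in> ?S" for x
    using that by (intro prob_glauber_step_escape[OF V])
      (auto simp: rooted_colourings_def tree_colourings_def split: if_splits)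
  then have "(\<Sum>x\<in>?S. measure_pmf.prob (glauber_step ?V tree_adj q x) (- ?S)) \<le> (\<Sum>x\<in>?S. 1 / card ?V)"
    by (intro sum_mono) simp
  also have "\<dots> = 1 / card ?V * card ?S" by simp
  finally have flow: "(\<Sum>x\<in>?S. measure_pmf.prob (glauber_step ?V tree_adj q x) (- ?S))
      \<le> 1 / card ?V * card ?S" .
  have "card ?S > 0" using assms num_rooted_pos[of q] by (simp add: card_rooted_colourings)
  then have "?S \<noteq> {}" by auto
  moreover have "card ?V > 0" using V by (simp add: card_gt_0_iff)
  ultimately show ?thesis
    using tree_glauber_bottleneck[OF assms, of 0 ?S b H "1 / card ?V" \<delta>] flow assms by simp
qed

text \<open>Only pivotal leaves lead out of the forced colourings. Summing over leaves instead of
  colourings, the number of leaves is offset by the probability of choosing a given vertex. The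
  factor 3/2 converts \<open>num_rooted\<close> into the size of the forced set.\<close>

lemma mixing_time_ge_exp_height:
  assumes small: "(real q - 1) * (real q - 1 - 2/3) ^ b \<le> (real q - 1) ^ b / 3"
    and rho: "(real q - 1) * (real q - 1 - 2/3) ^ (b - 1) \<le> \<rho> * (real q - 1) ^ (b - 1)"
    and q: "q \<ge> 3" and "\<rho> > 0"
  shows "ereal ((2 / 3 - \<delta>) / (3 / 2 * \<rho> ^ H)) \<le> ereal_of_enat (tree_glauber_mixing_time b H q \<delta>)"
proof -
  let ?V = "tree_verts b H" and ?S = "forced_colourings b q H 0" and ?N = "num_rooted b q H"
  let ?L = "{l \<in> ?V. length l = H}"
  let ?P = "\<lambda>x. measure_pmf.prob (glauber_step ?V tree_adj q x) (- ?S)"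
  have V: "finite ?V" "?V \<noteq> {}" "q > 0"
    using q finite_tree_verts by auto
  have cV: "card ?V > 0" using V by (simp add: card_gt_0_iff)
  have big: "2 * ?N \<le> 3 * card ?S"
    using card_forced_colourings[OF small q, of 0] q by simp
  have "?P x \<le> card {l \<in> ?L. x \<in> pivotal b q H l} / card ?V" if x: "x \<in> ?S" for x
  proof (rule prob_glauber_step_escape[OF V x])
    fix v c assume v: "v \<in> ?V" and xv: "x(v := c) \<in> proper_colourings ?V tree_adj q" "x(v := c) \<notin> ?S"
    have ne: "allowed b q H (x(v := c)) \<noteq> allowed b q H x"
      using x xv by (auto simp: forced_colourings_def tree_colourings_def)
    have "length v = H"
    proof (rule ccontr)
      assume "length v \<noteq> H"
      then have "allowed b q H (x(v := c)) = allowed b q H x"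
        by (intro allowed_cong) auto
      then show False using ne by simp
    qed
    moreover have "x \<in> pivotal b q H v"
      using x xv(1) ne unfolding pivotal_def forced_colourings_def tree_colourings_def by blast
    ultimately show "v \<in> {l \<in> ?L. x \<in> pivotal b q H l}" using v by simp
  qed auto
  then have "(\<Sum>x\<in>?S. ?P x) \<le> (\<Sum>x\<in>?S. card {l \<in> ?L. x \<in> pivotal b q H l} / card ?V)"
    by (rule sum_mono)
  also have "\<dots> = (\<Sum>x\<in>?S. \<Sum>l\<in>?L. of_bool (x \<in> pivotal b q H l)) / card ?V"
    using V(1) by (simp add: sum_divide_distrib[symmetric] Int_def)
  also have "\<dots> = (\<Sum>l\<in>?L. \<Sum>x\<in>?S. of_bool (x \<in> pivotal b q H l)) / card ?V"
    by (subst sum.swap) simp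
  also have "\<dots> = (\<Sum>l\<in>?L. real (card (?S \<inter> pivotal b q H l))) / card ?V"
    by (simp add: Int_def)
  also have "\<dots> \<le> (\<Sum>l\<in>?L. \<rho> ^ H * ?N) / card ?V"
  proof (intro divide_right_mono sum_mono)
    fix l assume l: "l \<in> ?L"
    have "card (?S \<inter> pivotal b q H l) \<le> card (rooted_colourings b q H 0 \<inter> pivotal b q H l)"
      using forced_subset_rooted[of b q H 0] by (intro card_mono) auto
    then have "real (card (?S \<inter> pivotal b q H l)) \<le> card (rooted_colourings b q H 0 \<inter> pivotal b q H l)"
      by simp
    also have "\<dots> \<le> \<rho> ^ H * ?N"
      using l q \<open>\<rho> > 0\<close> by (intro card_pivotal[OF small rho q]) (auto simp: tree_verts_def)
    finally show "real (card (?S \<inter> pivotal b q H l)) \<le> \<rho> ^ H * ?N" .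
  qed simp
  also have "\<dots> = \<rho> ^ H * ?N * (card ?L / card ?V)" by simp
  also have "\<dots> \<le> \<rho> ^ H * ?N * 1"
    using V(1) cV \<open>\<rho> > 0\<close> by (intro mult_left_mono) (auto simp: divide_le_eq intro!: card_mono)
  also have "\<dots> \<le> \<rho> ^ H * (3 / 2 * card ?S)"
    using big \<open>\<rho> > 0\<close> by simp
  finally have flow: "(\<Sum>x\<in>?S. ?P x) \<le> 3 / 2 * \<rho> ^ H * card ?S" by (simp add: algebra_simps)
  have "card ?S > 0" using big num_rooted_pos[OF q, of b H] by linarith
  then have "?S \<noteq> {}" by auto
  then show ?thesis
    using q \<open>\<rho> > 0\<close> by (intro tree_glauber_bottleneck[OF q _ forced_subset_rooted _ flow]) auto
qed

section \<open>Numerical estimates\<close>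

text \<open>The hypothesis gives \<open>6 * ln b \<le> b\<close>, which is bootstrapped:
  \<open>ln 2 \<ge> 2/3\<close> gives \<open>b \<ge> 3\<close>, then \<open>ln b \<ge> 1\<close>
  gives \<open>b \<ge> 6\<close>, then \<open>ln b \<ge> 3/2\<close> gives \<open>b \<ge> 9\<close>.
  The last bound follows from \<open>q \<le> b\<close>.\<close>

lemma degree_bounds:
  fixes b q :: nat
  assumes "b \<ge> 2" "q \<ge> 3" "real q \<le> real b / (2 * ln (real b))"
  shows "ln (real b) \<ge> 3 / 2" "b \<ge> 9" "2 * ln (real b) \<le> real b / real q"
    "real b / real q \<le> (real b - 1) / (real q - 1)"
proof -
  have lnpos: "ln (real b) > 0" using assms(1) by simp
  have qln: "real q * (2 * ln (real b)) \<le> real b"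
    using assms(3) lnpos by (simp add: le_divide_eq)
  have "3 * (2 * ln (real b)) \<le> real q * (2 * ln (real b))"
    using assms(2) lnpos by (intro mult_right_mono) auto
  then have b6: "6 * ln (real b) \<le> real b" using qln by linarith
  have "ln (real b) \<ge> ln 2" using assms(1) by simp
  then have "b \<ge> 3" using b6 ln2_ge_two_thirds by linarith
  have "exp 1 \<le> real b" using \<open>b \<ge> 3\<close> exp_le by linarith
  then have "ln (real b) \<ge> 1" using ln_ge_iff[of "real b" 1] assms(1) by simp
  then have "b \<ge> 6" using b6 by linarith
  have "exp (3 / 2) ^ 2 = exp (1::real) ^ 3"
    by (simp flip: exp_of_nat_mult)
  also have "\<dots> \<le> 3 ^ 3" by (intro power_mono exp_le) simp
  also have "\<dots> \<le> (6::real) ^ 2" by simp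
  finally have "exp (3 / 2 :: real) \<le> 6" by (rule power2_le_imp_le) simp
  then have "exp (3 / 2) \<le> real b" using \<open>b \<ge> 6\<close> by linarith
  then show ln: "ln (real b) \<ge> 3 / 2" using ln_ge_iff[of "real b" "3 / 2"] assms(1) by simp
  then show "b \<ge> 9" using b6 by linarith
  show "2 * ln (real b) \<le> real b / real q"
    using qln assms(2) by (simp add: le_divide_eq mult.commute)
  have "real q * 1 \<le> real q * (2 * ln (real b))"
    using ln by (intro mult_left_mono) auto
  then have "real q \<le> real b" using qln by linarith
  then show "real b / real q \<le> (real b - 1) / (real q - 1)"
    using assms(2) by (simp add: field_simps)
qed

text \<open>The \<open>k\<close>-th power of \<open>1 - x \<le> exp (- x)\<close> at
  \<open>x = 2 / (3 * m)\<close>.\<close>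

lemma power_sub_le_exp:
  fixes m :: real
  assumes "m \<ge> 1"
  shows "(m - 2 / 3) ^ k \<le> m ^ k * exp (- (2 / 3) * (k / m))"
proof -
  have "1 + (- (2 / 3) / m) \<le> exp (- (2 / 3) / m)" by (rule exp_ge_add_one_self)
  then have "m - 2 / 3 \<le> m * exp (- (2 / 3) / m)"
    using assms by (simp add: field_simps)
  then have "(m - 2 / 3) ^ k \<le> (m * exp (- (2 / 3) / m)) ^ k"
    using assms by (intro power_mono) auto
  also have "\<dots> = m ^ k * exp (- (2 / 3) * (k / m))"
    by (simp add: power_mult_distrib flip: exp_of_nat_mult)
  finally show ?thesis .
qed

text \<open>Since \<open>b / (q - 1)\<close> is at least \<open>2 * ln b\<close>, the exponential
  factor is at most \<open>1 / b\<close>, while \<open>q - 1\<close> is at most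
  \<open>b / 3\<close>.\<close>

lemma unforced_bound:
  fixes b q :: nat
  assumes "b \<ge> 2" "q \<ge> 3" "real q \<le> real b / (2 * ln (real b))"
  shows "(real q - 1) * (real q - 1 - 2/3) ^ b \<le> (real q - 1) ^ b / 3"
proof -
  note D = degree_bounds[OF assms]
  have q1: "real q - 1 \<ge> 1" using assms(2) by simp
  have "real b / real q \<le> real b / (real q - 1)"
    using q1 by (intro divide_left_mono) auto
  then have "- (2 / 3) * (b / (real q - 1)) \<le> - ln (real b)" using D by linarith
  then have "exp (- (2 / 3) * (b / (real q - 1))) \<le> exp (- ln (real b))" by simp
  also have "\<dots> = 1 / real b" using assms(1) by (simp add: exp_minus inverse_eq_divide)
  finally have "(real q - 1) * exp (- (2 / 3) * (b / (real q - 1))) \<le> (real q - 1) * (1 / real b)"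
    using q1 by (intro mult_left_mono) auto
  also have "\<dots> \<le> 1 / 3"
  proof -
    have "3 \<le> real b / real q" using D by linarith
    then have "3 * real q \<le> real b" using assms(2) by (simp add: le_divide_eq)
    then show ?thesis using assms(1) by (simp add: divide_le_eq)
  qed
  finally have *: "(real q - 1) * exp (- (2 / 3) * (b / (real q - 1))) \<le> 1 / 3" .
  have "(real q - 1) * (real q - 1 - 2/3) ^ b
      \<le> (real q - 1) * ((real q - 1) ^ b * exp (- (2 / 3) * (b / (real q - 1))))"
    using q1 by (intro mult_left_mono power_sub_le_exp) auto
  also have "\<dots> = (real q - 1) ^ b * ((real q - 1) * exp (- (2 / 3) * (b / (real q - 1))))" by simp
  also have "\<dots> \<le> (real q - 1) ^ b * (1 / 3)"
    using q1 by (intro mult_left_mono *) auto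
  finally show ?thesis by simp
qed

text \<open>Of the exponent \<open>2/3 * r\<close>, the portion \<open>r / 2\<close> pays for the
  factor \<open>q - 1\<close>, which is at most \<open>b\<close>. What remains is
  \<open>r / 6\<close>, the origin of the 6 in the final exponent.\<close>

lemma pivotal_bound:
  fixes b q :: nat
  assumes "b \<ge> 2" "q \<ge> 3" "real q \<le> real b / (2 * ln (real b))"
  shows "(real q - 1) * (real q - 1 - 2/3) ^ (b - 1)
    \<le> exp (- ((real b - 1) / (6 * (real q - 1)))) * (real q - 1) ^ (b - 1)"
proof -
  note D = degree_bounds[OF assms]
  define r where "r = (real b - 1) / (real q - 1)"
  have q1: "real q - 1 \<ge> 1" using assms(2) by simp
  have "3 \<le> real b / real q" using D by linarith
  then have "3 * real q \<le> real b" using assms(2) by (simp add: le_divide_eq)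
  then have "real q - 1 \<le> exp (ln (real b))" using assms(1) by simp
  also have "\<dots> \<le> exp (1 / 2 * r)" unfolding exp_le_cancel_iff r_def using D by linarith
  finally have "(real q - 1) * exp (- (2 / 3) * r) \<le> exp (1 / 2 * r) * exp (- (2 / 3) * r)"
    by (intro mult_right_mono) auto
  also have "\<dots> = exp (- (r / 6))" by (simp add: exp_add[symmetric])
  finally have *: "(real q - 1) * exp (- (2 / 3) * r) \<le> exp (- (r / 6))" .
  have "(real q - 1) * (real q - 1 - 2/3) ^ (b - 1)
      \<le> (real q - 1) * ((real q - 1) ^ (b - 1) * exp (- (2 / 3) * (real (b - 1) / (real q - 1))))"
    using q1 by (intro mult_left_mono power_sub_le_exp) auto
  also have "\<dots> = (real q - 1) ^ (b - 1) * ((real q - 1) * exp (- (2 / 3) * r))"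
    using assms(1) by (simp add: of_nat_diff r_def)
  also have "\<dots> \<le> (real q - 1) ^ (b - 1) * exp (- (r / 6))"
    using q1 by (intro mult_left_mono *) auto
  finally show ?thesis by (simp add: mult.commute r_def)
qed

section \<open>From the height to the number of vertices\<close>

lemma card_tree_verts_sum: "card (tree_verts b H) = (\<Sum>i\<le>H. b ^ i)"
  unfolding tree_verts_def using card_lists_length_le[of "{..<b}" H] by simp

lemma card_tree_verts_ge:
  assumes "H > 0"
  shows "card (tree_verts b H) \<ge> b"
  using assms member_le_sum[of 1 "{..H}" "\<lambda>i. b ^ i"] by (simp add: card_tree_verts_sum)

lemma ln_card_tree_verts_le:
  assumes "b \<ge> 2"
  shows "ln (real (card (tree_verts b H))) \<le> H * ln b + 1 / (real b - 1)"
proof -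
  let ?n = "real (card (tree_verts b H))"
  have b: "real b > 1" using assms by simp
  have n: "?n > 0" using finite_tree_verts[of b H] Nil_in_tree_verts by (auto simp: card_gt_0_iff)
  have "(real b - 1) * ?n = real b ^ Suc H - 1"
    using sum_gp_basic[of "real b" H] by (simp add: card_tree_verts_sum algebra_simps)
  then have "?n \<le> real b ^ H * (real b / (real b - 1))"
    using b by (simp add: field_simps)
  then have "ln ?n \<le> ln (real b ^ H * (real b / (real b - 1)))"
    using n b by simp
  also have "\<dots> = H * ln b + ln (real b / (real b - 1))"
    using b by (subst ln_mult) (simp_all add: ln_realpow)
  also have "real b / (real b - 1) = 1 + 1 / (real b - 1)"
    using b by (simp add: field_simps)
  also have "ln (1 + 1 / (real b - 1)) \<le> 1 / (real b - 1)"
    using b by (intro ln_add_one_self_le_self) auto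
  finally show ?thesis by simp
qed

lemma half_inverse_e_le: "1 / (2 * exp 1) \<le> (1 / 5 :: real)"
proof -
  have "5 / 2 \<le> (exp 1 :: real)"
    using exp_lower_Taylor_quadratic[of "1 :: real"] by simp
  then show ?thesis
    by (intro divide_left_mono) auto
qed

text \<open>The first bound serves the one-vertex tree, the second absorbs constants when the
  exponential is small, and the third carries the power of \<open>n\<close>. Here 7/15 is
  \<open>2/3 - 1/5\<close>, with 1/5 bounding \<open>1 / (2 * exp 1)\<close>.\<close>

lemma mixing_time_lower_bounds:
  fixes b q H :: nat and \<tau> :: ereal and \<kappa> :: real
  assumes "b \<ge> 2" "3 \<le> q" "real q \<le> real b / (2 * ln (real b))"
  defines "\<tau> \<equiv> ereal_of_enat (tree_glauber_mixing_time b H q (1 / (2 * exp 1)))"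
    and "\<kappa> \<equiv> (real b - 1) / (6 * (real q - 1))"
  shows "1 \<le> \<tau>"
    and "ereal (7 / 15 * card (tree_verts b H)) \<le> \<tau>"
    and "ereal (2 / 3 * (2 / 3 - 1 / (2 * exp 1)) * exp (\<kappa> * H)) \<le> \<tau>"
proof -
  have "tree_colourings b q H \<noteq> {}"
    using num_rooted_pos[OF assms(2), of b H] assms(2) card_tree_colourings[of b q H] by auto
  then show "1 \<le> \<tau>"
    unfolding \<tau>_def tree_glauber_mixing_time_def Let_def
    by (intro mixing_time_ge_1) (simp_all flip: tree_colourings_def)
  have "7 / 15 * real (card (tree_verts b H)) \<le> (2 / 3 - 1 / (2 * exp 1)) * card (tree_verts b H)"
    using half_inverse_e_le by (intro mult_right_mono) linarith+
  then show "ereal (7 / 15 * card (tree_verts b H)) \<le> \<tau>"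
    unfolding \<tau>_def by (intro order.trans[OF _ mixing_time_ge_size[OF assms(2)]]) simp
  have recip: "a / (3 / 2 * inverse x) = 2 / 3 * a * x" for a x :: real
    by (cases "x = 0") (simp_all add: field_simps)
  have "ereal ((2 / 3 - 1 / (2 * exp 1)) / (3 / 2 * exp (- \<kappa>) ^ H)) \<le> \<tau>"
    unfolding \<tau>_def \<kappa>_def
    by (rule mixing_time_ge_exp_height[OF unforced_bound[OF assms(1-3)] pivotal_bound[OF assms(1-3)] assms(2)])
      simp
  also have "exp (- \<kappa>) ^ H = inverse (exp (\<kappa> * H))"
    using exp_of_nat_mult[of H "- \<kappa>"] by (simp add: exp_minus mult.commute)
  also have "(2 / 3 - 1 / (2 * exp 1)) / (3 / 2 * inverse (exp (\<kappa> * H)))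
      = 2 / 3 * (2 / 3 - 1 / (2 * exp 1)) * exp (\<kappa> * H)"
    by (rule recip)
  finally show "ereal (2 / 3 * (2 / 3 - 1 / (2 * exp 1)) * exp (\<kappa> * H)) \<le> \<tau>" .
qed

theorem theorem2:
  shows "(\<exists>C::real. C > 0 \<and>
            (\<forall>b q H :: nat. b \<ge> 2 \<longrightarrow> 3 \<le> q \<longrightarrow> real q \<le> real b / (2 * ln (real b)) \<longrightarrow>
              ereal (real (card (tree_verts b H)) powr (C * (real b / (real q * ln (real b)))))
                \<le> ereal_of_enat (tree_glauber_mixing_time b H q (1 / (2 * exp 1)))))
       \<and> (\<forall>b q H :: nat. b \<ge> 2 \<longrightarrow> 3 \<le> q \<longrightarrow> real q \<le> real b / (2 * ln (real b)) \<longrightarrow>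
            ereal ((1 / 2 - 1 / (2 * exp 1)) * (2 / 9) *
                real (card (tree_verts b H)) powr
                  ((real b - 2) / (6 * (real q - 1) * ln (real b))))
              \<le> ereal_of_enat (tree_glauber_mixing_time b H q (1 / (2 * exp 1))))"
\<comment> \<open>With 1/24 the power of \<open>n\<close> is at most
  \<open>exp (\<kappa> * H / 2)\<close>, because \<open>ln n \<le> 2 * H * ln b\<close>. This is
  only the square root of the available exponential, and the surplus pays for the constant
  factor.\<close>
proof (intro conjI exI[of _ "1 / 24"] allI impI)
  fix b q H :: nat
  assume A: "b \<ge> 2" "3 \<le> q" "real q \<le> real b / (2 * ln (real b))"
  let ?\<tau> = "ereal_of_enat (tree_glauber_mixing_time b H q (1 / (2 * exp 1)))"
  let ?n = "real (card (tree_verts b H))"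
  define \<kappa> :: real where "\<kappa> = (real b - 1) / (6 * (real q - 1))"
  note D = degree_bounds[OF A]
  note L = mixing_time_lower_bounds[OF A, of H, folded \<kappa>_def]
  have n: "?n > 0"
    using finite_tree_verts[of b H] by (simp add: card_gt_0_iff)
  show "ereal (?n powr (1 / 24 * (real b / (real q * ln (real b))))) \<le> ?\<tau>"
  proof (cases "H = 0")
    case True
    then show ?thesis using L(1) by (simp add: one_ereal_def)
  next
    case False
    have "1 / (real b - 1) \<le> 1" using A(1) by (simp add: divide_le_eq)
    also have "\<dots> \<le> 1 * ln (real b)" using D(1) by linarith
    also have "\<dots> \<le> H * ln (real b)"
      using False D by (intro mult_right_mono) auto
    finally have "ln ?n \<le> 2 * (H * ln (real b))"
      using ln_card_tree_verts_le[OF A(1), of H] by linarith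
    then have "1 / 24 * (real b / (real q * ln (real b))) * ln ?n
        \<le> 1 / 24 * (real b / (real q * ln (real b))) * (2 * (H * ln (real b)))"
      using D by (intro mult_left_mono) auto
    also have "\<dots> = 1 / 12 * H * (real b / real q)"
      using D by (simp add: field_simps)
    also have "\<dots> \<le> 1 / 12 * H * ((real b - 1) / (real q - 1))"
      by (intro mult_left_mono D) auto
    also have "\<dots> = \<kappa> * H / 2" by (simp add: \<kappa>_def)
    finally have le: "?n powr (1 / 24 * (real b / (real q * ln (real b)))) \<le> exp (\<kappa> * H / 2)"
      using n by (simp add: powr_def)
    define s where "s = exp (\<kappa> * H / 2)"
    have s2: "exp (\<kappa> * H) = s * s" by (simp add: s_def flip: exp_add)
    \<comment> \<open>The third bound is at least \<open>14/45 * s * s\<close>, which suffices once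
      \<open>s \<ge> 45/14\<close>. A smaller \<open>s\<close> is below \<open>7/15 * 9\<close>, and
      \<open>n \<ge> 9\<close>.\<close>
    have "ereal s \<le> ?\<tau>"
    proof (cases "s \<ge> 45 / 14")
      case True
      have "s * 1 \<le> s * (14 / 45 * s)" using True by (intro mult_left_mono) auto
      also have "\<dots> = 2 / 3 * (2 / 3 - 1 / 5) * exp (\<kappa> * H)" by (simp add: s2)
      also have "\<dots> \<le> 2 / 3 * (2 / 3 - 1 / (2 * exp 1)) * exp (\<kappa> * H)"
        by (intro mult_right_mono mult_left_mono diff_left_mono half_inverse_e_le) auto
      finally show ?thesis by (intro order.trans[OF _ L(3)]) simp
    next
      case False
      have "?n \<ge> 9"
        using card_tree_verts_ge[of H b] D(2) \<open>H \<noteq> 0\<close> by linarith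
      then have "s \<le> 7 / 15 * ?n" using False by linarith
      then show ?thesis by (intro order.trans[OF _ L(2)]) simp
    qed
    with le show ?thesis
      unfolding s_def by (meson ereal_less_eq(3) order.trans)
  qed
  define E :: real where "E = (real b - 2) / (6 * (real q - 1) * ln (real b))"
  have E0: "E \<ge> 0" unfolding E_def using A D(1) by simp
  have "E * ln ?n \<le> E * (H * ln b + 1 / (real b - 1))"
    by (rule mult_left_mono[OF ln_card_tree_verts_le[OF A(1)] E0])
  also have "\<dots> = E * ln b * H + E / (real b - 1)"
    by (simp add: ring_distribs)
  also have "\<dots> = (real b - 2) / (6 * (real q - 1)) * H + E / (real b - 1)"
    using D(1) by (simp add: E_def)
  \<comment> \<open>The excess of \<open>ln n\<close> over \<open>H * ln b\<close> contributes at
    most 1 to the exponent, that is, a factor \<open>exp 1 \<le> 3\<close>; with 2/9 this gives the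
    2/3 of the third bound.\<close>
  also have "\<dots> \<le> \<kappa> * H + 1"
  proof (intro add_mono mult_right_mono)
    show "(real b - 2) / (6 * (real q - 1)) \<le> \<kappa>"
      unfolding \<kappa>_def using A by (intro divide_right_mono) auto
    have "1 * 1 \<le> 6 * (real q - 1) * ln (real b)"
      using A D(1) by (intro mult_mono) auto
    then have "E \<le> (real b - 2) / 1"
      unfolding E_def using A by (intro divide_left_mono) auto
    then show "E / (real b - 1) \<le> 1" using A by (simp add: divide_le_eq)
  qed simp
  finally have "?n powr E \<le> exp (\<kappa> * H + 1)"
    using n by (simp add: powr_def mult.commute)
  also have "\<dots> \<le> exp (\<kappa> * H) * 3"
    unfolding exp_add by (intro mult_left_mono exp_le) simp
  finally have "(1 / 2 - 1 / (2 * exp 1)) * (2 / 9) * ?n powr E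
      \<le> (1 / 2 - 1 / (2 * exp 1)) * (2 / 9) * (exp (\<kappa> * H) * 3)"
    using half_inverse_e_le by (intro mult_left_mono) auto
  also have "\<dots> = 2 / 3 * (1 / 2 - 1 / (2 * exp 1)) * exp (\<kappa> * H)" by simp
  also have "\<dots> \<le> 2 / 3 * (2 / 3 - 1 / (2 * exp 1)) * exp (\<kappa> * H)"
    by (intro mult_right_mono mult_left_mono) auto
  finally show "ereal ((1 / 2 - 1 / (2 * exp 1)) * (2 / 9) *
      ?n powr ((real b - 2) / (6 * (real q - 1) * ln (real b)))) \<le> ?\<tau>"
    unfolding E_def by (intro order.trans[OF _ L(3)]) simp
qed simp

end
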